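(* Let $X$ be a topological space, let $\vec f=(f_1,\ldots,f_n):X\to\mathbb R^n$ be a max-tame function, and let $(\vec l,\vec b)$ be an admissible pair in $\mathbb R^n\times\mathbb R^n$, with $\vec l=(l_1,\ldots,l_n)$ and $\vec b=(b_1,\ldots,b_n)$. Define $g:X\to\mathbb R$ by $$g(P)=\max_{j=1,\ldots,n}\left\{\frac{f_j(P)-b_j}{l_j}\right\}.$$ Then, for all $i\in\mathbb Z$ and all $s,t\in\mathbb R$ with $s<t$, setting $\vec u=s\vec l+\vec b$ and $\vec v=t\vec l+\vec b$, the equality $$F_i^{\vec u,\vec v}=G_i^{s,t}$$ holds, where $F_i^{\vec u,\vec v}$ is the $i$-th multidimensional persistent homology module of $\vec f$ and $G_i^{s,t}$ is the $i$-th persistent homology module of $g$.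
   Context: $H_i(\cdot)$ denotes the $i$-th singular homology module with coefficients in a fixed field $k$. Admissible pairs: a pair $(\vec l,\vec b)$ of vectors in $\mathbb R^n$ is admissible if $\vec l=(l_1,\ldots,l_n)$ is a unit vector with $l_j>0$ for all $j$, and $\vec b=(b_1,\ldots,b_n)$ satisfies $\sum_{j=1}^n b_j=0$. Tameness: a homological critical value of a real function $f$ on a topological space $X$ is a real number $a$ for which there exists an integer $i$ such that, for all sufficiently small $\varepsilon>0$, the map $H_i(f^{-1}(-\infty,a-\varepsilon])\to H_i(f^{-1}(-\infty,a+\varepsilon])$ induced by inclusion is not an isomorphism. A function $f:X\to\mathbb R$ is tame if it has a finite number of homological critical values and the modules $H_i(f^{-1}(-\infty,a])$ are finite-dimensional for all $i\in\mathbb Z$ and $a\in\mathbb R$. A continuous function $\vec f=(f_1,\ldots,f_n):X\to\mathbb R^n$ is max-tame if, for every admissible pair $(\vec l,\vec b)$, the function $P\mapsto\max_{j=1,\ldots,n}\{(f_j(P)-b_j)/l_j\}$ is tame. Order: for $\vec u,\vec v\in\mathbb R^n$, $\vec u\preceq\vec v$ means $u_j\le v_j$ for all $j=1,\ldots,n$. Persistent homology modules: for $\vec u\in\mathbb R^n$ put $F_i^{\vec u}=H_i\big(\vec f^{-1}(\prod_{j=1}^n(-\infty,u_j])\big)$; for $\vec u\preceq\vec v$ let $f_i^{\vec u,\vec v}:F_i^{\vec u}\to F_i^{\vec v}$ be the map induced by inclusion of the lower level set of $\vec u$ in that of $\vec v$, and $F_i^{\vec u,\vec v}=\operatorname{Im}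 f_i^{\vec u,\vec v}$ (the $i$-th multidimensional persistent homology module). For $s\in\mathbb R$ put $G_i^s=H_i(g^{-1}(-\infty,s])$; for $s<t$ let $g_i^{s,t}:G_i^s\to G_i^t$ be the map induced by inclusion, and $G_i^{s,t}=\operatorname{Im} g_i^{s,t}$ (the $i$-th persistent homology module). *)

theory Defs
  imports
    "HOL-Homology.Homology"
    "Jordan_Normal_Form.Missing_VectorSpace"
begin

section \<open>Quotients and images of modules\<close>

definition field_ring :: "'k::field ring"
  where "field_ring = \<lparr> carrier = UNIV, mult = (*), one = 1, zero = 0, add = (+) \<rparr>"

text \<open>The union in the scalar multiplication is over equal cosets (see \<open>quotient_smult\<close>).
  Multiplying the coset pointwise instead would be wrong for the scalar zero.\<close>

definition quotient_module :: "('r, 'm) module \<Rightarrow> 'm set \<Rightarrow> ('r, 'm set) module"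
  where "quotient_module M N =
    \<lparr> carrier = a_rcosets\<^bsub>M\<^esub> N, mult = undefined, one = undefined,
      zero = N, add = set_add M,
      smult = (\<lambda>a C. \<Union>x\<in>C. N +>\<^bsub>M\<^esub> (a \<odot>\<^bsub>M\<^esub> x)) \<rparr>"

definition image_module :: "('r, 'm) module \<Rightarrow> ('r, 'n) module \<Rightarrow> ('m \<Rightarrow> 'n) \<Rightarrow> ('r, 'n) module"
  where "image_module M N h = N\<lparr>carrier := h ` carrier M\<rparr>"

definition module_isomorphism ::
    "('r, 'q) ring_scheme \<Rightarrow> ('r, 'm) module \<Rightarrow> ('r, 'n) module \<Rightarrow> ('m \<Rightarrow> 'n) \<Rightarrow> bool"
  where "module_isomorphism R M N h \<longleftrightarrow>
    h \<in> module_hom R M N \<and> bij_betw h (carrier M) (carrier N)"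


section \<open>Singular homology with coefficients in a field\<close>

text \<open>The library's chains have integer coefficients, so chains over a field are built here on top
  of the library's singular simplices. The coefficient field is a type of class \<open>field\<close>.
  Degrees are integers; there are no simplices in negative degree.\<close>

type_synonym ('a, 'k) field_chain = "((nat \<Rightarrow> real) \<Rightarrow> 'a) \<Rightarrow>\<^sub>0 'k"

definition chain_smult :: "'k \<Rightarrow> ('b \<Rightarrow>\<^sub>0 'k) \<Rightarrow> ('b \<Rightarrow>\<^sub>0 'k::field)"
  where "chain_smult a c = Poly_Mapping.map ((*) a) c"

definition linear_extension :: "('b \<Rightarrow> ('c \<Rightarrow>\<^sub>0 'k)) \<Rightarrow> ('b \<Rightarrow>\<^sub>0 'k) \<Rightarrow> ('c \<Rightarrow>\<^sub>0 'k::field)"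
  where "linear_extension \<phi> c =
    (\<Sum>\<sigma>\<in>Poly_Mapping.keys c. chain_smult (Poly_Mapping.lookup c \<sigma>) (\<phi> \<sigma>))"

definition chain_space :: "int \<Rightarrow> 'a topology \<Rightarrow> ('k::field, ('a, 'k) field_chain) module"
  where "chain_space i X =
    \<lparr> carrier = {c. Poly_Mapping.keys c \<subseteq> {\<sigma>. 0 \<le> i \<and> singular_simplex (nat i) X \<sigma>}},
      mult = undefined, one = undefined, zero = 0, add = (+), smult = chain_smult \<rparr>"

definition boundary_map :: "int \<Rightarrow> ('a, 'k) field_chain \<Rightarrow> ('a, 'k::field) field_chain"
  where "boundary_map i c =
    (if i \<le> 0 then 0
     else linear_extension
       (\<lambda>\<sigma>. \<Sum>j\<le>nat i. Poly_Mapping.single (singular_face (nat i) j \<sigma>) ((-1) ^ j)) c)"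

definition cycle_space :: "int \<Rightarrow> 'a topology \<Rightarrow> ('k::field, ('a, 'k) field_chain) module"
  where "cycle_space i X =
    (chain_space i X)\<lparr>carrier := {c \<in> carrier (chain_space i X). boundary_map i c = 0}\<rparr>"

definition boundaries :: "int \<Rightarrow> 'a topology \<Rightarrow> ('a, 'k::field) field_chain set"
  where "boundaries i X = boundary_map (i + 1) ` carrier (chain_space (i + 1) X)"

definition homology_module ::
    "int \<Rightarrow> 'a topology \<Rightarrow> ('k::field, ('a, 'k) field_chain set) module"
  where "homology_module i X = quotient_module (cycle_space i X) (boundaries i X)"

definition induced_chain_map ::
    "int \<Rightarrow> ('a \<Rightarrow> 'b) \<Rightarrow> ('a, 'k) field_chain \<Rightarrow> ('b, 'k::field) field_chain"
  where "induced_chain_map i g =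
    linear_extension (\<lambda>\<sigma>. Poly_Mapping.single (simplex_map (nat i) g \<sigma>) 1)"

text \<open>The class of a cycle \<open>c\<close> is sent to the class of its push-forward; again the union is over
  equal cosets (see \<open>induced_homology_map_coset\<close>).\<close>

definition induced_homology_map ::
    "int \<Rightarrow> 'b topology \<Rightarrow> ('a \<Rightarrow> 'b) \<Rightarrow> ('a, 'k) field_chain set \<Rightarrow> ('b, 'k::field) field_chain set"
  where "induced_homology_map i Y g C =
    (\<Union>c\<in>C. boundaries i Y +>\<^bsub>cycle_space i Y\<^esub> induced_chain_map i g c)"


section \<open>Persistent homology, tameness, admissible pairs\<close>

text \<open>On \<^typ>\<open>real ^ 'n\<close> the library order is the componentwise one, so that \<open>{..u}\<close> is the
  product of the half-lines \<open>{..u $ j}\<close>.\<close>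

definition lower_level :: "'a topology \<Rightarrow> ('a \<Rightarrow> 'v::order) \<Rightarrow> 'v \<Rightarrow> 'a topology"
  where "lower_level X f u = subtopology X (f -` {..u})"

definition persistent_homology_module ::
    "int \<Rightarrow> 'a topology \<Rightarrow> ('a \<Rightarrow> 'v::order) \<Rightarrow> 'v \<Rightarrow> 'v \<Rightarrow>
      ('k::field, ('a, 'k) field_chain set) module"
  where "persistent_homology_module i X f u v =
    image_module (homology_module i (lower_level X f u)) (homology_module i (lower_level X f v))
      (induced_homology_map i (lower_level X f v) id)"

text \<open>The coefficient field does not occur in the remaining arguments, hence the type token.\<close>

definition homological_critical_value ::
    "'k::field itself \<Rightarrow> 'a topology \<Rightarrow> ('a \<Rightarrow> real) \<Rightarrow> real \<Rightarrow> bool"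
  where "homological_critical_value k X f a \<longleftrightarrow>
    (\<exists>i::int. \<forall>\<^sub>F \<epsilon> in at_right 0.
      \<not> module_isomorphism (field_ring :: 'k ring)
          (homology_module i (lower_level X f (a - \<epsilon>)))
          (homology_module i (lower_level X f (a + \<epsilon>)))
          (induced_homology_map i (lower_level X f (a + \<epsilon>)) id))"

definition tame :: "'k::field itself \<Rightarrow> 'a topology \<Rightarrow> ('a \<Rightarrow> real) \<Rightarrow> bool"
  where "tame k X f \<longleftrightarrow>
    finite {a. homological_critical_value k X f a} \<and>
    (\<forall>(i::int) a. vectorspace.fin_dim (field_ring :: 'k ring)
      (homology_module i (lower_level X f a)))"

definition admissible :: "real ^ 'n \<Rightarrow> real ^ 'n \<Rightarrow> bool"
  where "admissible l b \<longleftrightarrow> norm l = 1 \<and> (\<forall>j. l $ j > 0) \<and> (\<Sum>j\<in>UNIV. b $ j) = 0"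

definition max_tame :: "'k::field itself \<Rightarrow> 'a topology \<Rightarrow> ('a \<Rightarrow> real ^ 'n) \<Rightarrow> bool"
  where "max_tame k X f \<longleftrightarrow>
    continuous_map X euclidean f \<and>
    (\<forall>l b. admissible l b \<longrightarrow> tame k X (\<lambda>P. MAX j. (f P $ j - b $ j) / l $ j))"


section \<open>The definitions have the expected properties\<close>

lemma lookup_chain_smult [simp]:
  "Poly_Mapping.lookup (chain_smult a c) \<sigma> = a * Poly_Mapping.lookup c \<sigma>"
  by (simp add: chain_smult_def Poly_Mapping.map.rep_eq when_def)

lemma keys_chain_smult: "Poly_Mapping.keys (chain_smult a c) \<subseteq> Poly_Mapping.keys c"
  by (auto simp: in_keys_iff)

lemma chain_smult_simps [simp]:
  "chain_smult 0 c = 0" "chain_smult a 0 = 0" "chain_smult 1 c = c"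
  "chain_smult a (chain_smult b c) = chain_smult (a * b) c"
  "chain_smult a (Poly_Mapping.single \<sigma> b) = Poly_Mapping.single \<sigma> (a * b)"
  by (auto intro!: poly_mapping_eqI simp: lookup_single when_def)

lemma chain_smult_add:
  "chain_smult a (c + d) = chain_smult a c + chain_smult a d"
  "chain_smult (a + b) c = chain_smult a c + chain_smult b c"
  by (auto intro!: poly_mapping_eqI simp: lookup_add algebra_simps)

lemma chain_smult_sum: "chain_smult a (sum F A) = (\<Sum>x\<in>A. chain_smult a (F x))"
  by (induction A rule: infinite_finite_induct) (auto simp: chain_smult_add)

lemma chain_smult_minus_one: "chain_smult (- 1) c = - c"
  by (auto intro!: poly_mapping_eqI)

lemma linear_extension_superset:
  assumes "finite A" "Poly_Mapping.keys c \<subseteq> A"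
  shows "linear_extension \<phi> c = (\<Sum>\<sigma>\<in>A. chain_smult (Poly_Mapping.lookup c \<sigma>) (\<phi> \<sigma>))"
  unfolding linear_extension_def using assms
  by (intro sum.mono_neutral_left) (auto simp: in_keys_iff)

lemma linear_extension_add:
  "linear_extension \<phi> (c + d) = linear_extension \<phi> c + linear_extension \<phi> d"
proof -
  let ?A = "Poly_Mapping.keys c \<union> Poly_Mapping.keys d"
  have "Poly_Mapping.keys (c + d) \<subseteq> ?A"
    by (rule keys_add)
  then show ?thesis
    by (simp add: linear_extension_superset[of ?A] lookup_add chain_smult_add sum.distrib)
qed

lemma linear_extension_smult:
  "linear_extension \<phi> (chain_smult a c) = chain_smult a (linear_extension \<phi> c)"
  by (subst linear_extension_superset[OF finite_keys keys_chain_smult])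
    (simp add: linear_extension_def chain_smult_sum)

lemma linear_extension_0 [simp]: "linear_extension \<phi> 0 = 0"
  by (simp add: linear_extension_def)

lemma linear_extension_sum:
  "linear_extension \<phi> (sum F A) = (\<Sum>x\<in>A. linear_extension \<phi> (F x))"
  by (induction A rule: infinite_finite_induct) (auto simp: linear_extension_add)

lemma linear_extension_single [simp]:
  "linear_extension \<phi> (Poly_Mapping.single \<sigma> a) = chain_smult a (\<phi> \<sigma>)"
  by (subst linear_extension_superset[of "{\<sigma>}"]) auto

lemma linear_extension_compose:
  "linear_extension \<psi> (linear_extension \<phi> c) = linear_extension (\<lambda>\<sigma>. linear_extension \<psi> (\<phi> \<sigma>)) c"
  unfolding linear_extension_def[of \<phi>] linear_extension_def[of "\<lambda>\<sigma>. linear_extension \<psi> (\<phi> \<sigma>)"]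
  by (simp add: linear_extension_sum linear_extension_smult)

lemma linear_extension_cong:
  "(\<And>\<sigma>. \<sigma> \<in> Poly_Mapping.keys c \<Longrightarrow> \<phi> \<sigma> = \<psi> \<sigma>) \<Longrightarrow> linear_extension \<phi> c = linear_extension \<psi> c"
  by (simp add: linear_extension_def)

lemma keys_linear_extension:
  assumes "\<And>\<sigma>. \<sigma> \<in> Poly_Mapping.keys c \<Longrightarrow> Poly_Mapping.keys (\<phi> \<sigma>) \<subseteq> B"
  shows "Poly_Mapping.keys (linear_extension \<phi> c) \<subseteq> B"
proof -
  have "Poly_Mapping.keys (linear_extension \<phi> c)
      \<subseteq> (\<Union>\<sigma>\<in>Poly_Mapping.keys c. Poly_Mapping.keys (chain_smult (Poly_Mapping.lookup c \<sigma>) (\<phi> \<sigma>)))"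
    unfolding linear_extension_def by (rule keys_sum)
  also have "\<dots> \<subseteq> B"
    using assms keys_chain_smult by fastforce
  finally show ?thesis .
qed

lemma boundary_map_linear:
  "boundary_map i (c + d) = boundary_map i c + boundary_map i d"
  "boundary_map i (chain_smult a c) = chain_smult a (boundary_map i c)"
  "boundary_map i 0 = 0"
  by (auto simp: boundary_map_def linear_extension_add linear_extension_smult)

lemma induced_chain_map_linear:
  "induced_chain_map i g (c + d) = induced_chain_map i g c + induced_chain_map i g d"
  "induced_chain_map i g (chain_smult a c) = chain_smult a (induced_chain_map i g c)"
  "induced_chain_map i g 0 = 0"
  by (auto simp: induced_chain_map_def linear_extension_add linear_extension_smult)

lemma boundary_map_closed:
  assumes "c \<in> carrier (chain_space i X)"
  shows "boundary_map i c \<in> carrier (chain_space (i - 1) X)"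
proof (cases "i \<le> 0")
  case False
  have "Poly_Mapping.keys (\<Sum>j\<le>nat i. Poly_Mapping.single (singular_face (nat i) j \<sigma>) ((-1) ^ j :: 'b))
      \<subseteq> {\<sigma>. 0 \<le> i - 1 \<and> singular_simplex (nat (i - 1)) X \<sigma>}"
    if "\<sigma> \<in> Poly_Mapping.keys c" for \<sigma>
  proof -
    have "singular_simplex (nat i) X \<sigma>"
      using that assms by (auto simp: chain_space_def)
    then have *: "singular_simplex (nat (i - 1)) X (singular_face (nat i) j \<sigma>)" if "j \<le> nat i" for j
      using singular_simplex_singular_face[of "nat i" X \<sigma> j] False that
      by (simp add: nat_diff_distrib)
    have "Poly_Mapping.keys (\<Sum>j\<le>nat i. Poly_Mapping.single (singular_face (nat i) j \<sigma>) ((-1) ^ j :: 'b))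
        \<subseteq> (\<Union>j\<in>{..nat i}. {singular_face (nat i) j \<sigma>})"
      by (rule order_trans[OF keys_sum]) auto
    then show ?thesis
      using * False by auto
  qed
  then have "Poly_Mapping.keys (boundary_map i c)
      \<subseteq> {\<sigma>. 0 \<le> i - 1 \<and> singular_simplex (nat (i - 1)) X \<sigma>}"
    using False unfolding boundary_map_def by (simp only: if_False) (rule keys_linear_extension)
  then show ?thesis
    by (simp add: chain_space_def)
qed (simp add: boundary_map_def chain_space_def)

lemma singular_face_singular_face:
  assumes "2 \<le> p" "i \<le> j" "j \<le> p - Suc 0"
  shows "singular_face (p - Suc 0) i (singular_face p (Suc j) \<sigma>) =
         singular_face (p - Suc 0) j (singular_face p i \<sigma>)"
proof
  fix t
  show "singular_face (p - Suc 0) i (singular_face p (Suc j) \<sigma>) t =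
        singular_face (p - Suc 0) j (singular_face p i \<sigma>) t"
  proof (cases "t \<in> standard_simplex (p - 1 - 1)")
    case True
    have fi: "simplical_face i t \<in> standard_simplex (p - Suc 0)"
      using assms True simplical_face_in_standard_simplex by force
    have fj: "simplical_face j t \<in> standard_simplex (p - Suc 0)"
      using assms True simplical_face_in_standard_simplex by force
    have eq: "simplical_face (Suc j) (simplical_face i t) = simplical_face i (simplical_face j t)"
      using True assms unfolding standard_simplex_def simplical_face_def by fastforce
    show ?thesis by (simp add: singular_face_def fi fj eq)
  qed (simp add: singular_face_def)
qed

lemma boundary_map_boundary_map: "boundary_map i (boundary_map (i + 1) c) = 0"
proof (cases "i \<le> 0")
  case False
  define p where "p = nat (i + 1)"
  have p: "2 \<le> p" and ni: "nat i = p - Suc 0"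
    using False by (auto simp: p_def)
  have "(\<Sum>x\<le>p. \<Sum>k\<le>p - Suc 0. Poly_Mapping.single
      (singular_face (p - Suc 0) k (singular_face p x \<sigma>)) ((-1) ^ (x + k) :: 'b)) = 0" for \<sigma> :: "(nat \<Rightarrow> real) \<Rightarrow> 'a"
  proof -
    define h where "h = (\<lambda>(x, k). Poly_Mapping.single
      (singular_face (p - Suc 0) k (singular_face p x \<sigma>)) ((-1) ^ (x + k) :: 'b))"
    define L where "L = {(x, k). x \<le> p \<and> k \<le> p - Suc 0 \<and> k < x}"
    define U where "U = {(x, k). x \<le> k \<and> k \<le> p - Suc 0}"
    have split: "{..p} \<times> {..p - Suc 0} = L \<union> U" "L \<inter> U = {}"
      using p by (auto simp: L_def U_def)
    then have fin: "finite L" "finite U"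
      by (metis finite_SigmaI finite_Un finite_atMost)+
    have L: "L = (\<lambda>(x, k). (Suc k, x)) ` U"
    proof (intro Set.set_eqI iffI)
      fix z assume "z \<in> L"
      then obtain x k where "z = (Suc x, k)" "(k, x) \<in> U"
        using p unfolding L_def U_def by (cases z; cases "fst z") auto
      then show "z \<in> (\<lambda>(x, k). (Suc k, x)) ` U"
        by force
    qed (use p in \<open>auto simp: L_def U_def\<close>)
    have "sum h L = (\<Sum>z\<in>U. - h z)"
      unfolding L
    proof (subst sum.reindex)
      show "(\<Sum>z\<in>U. (h \<circ> (\<lambda>(x, k). (Suc k, x))) z) = (\<Sum>z\<in>U. - h z)"
        using p by (intro sum.cong)
          (auto simp: h_def U_def singular_face_singular_face single_uminus add.commute)
    qed (auto simp: inj_on_def)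
    then have "sum h (L \<union> U) = 0"
      by (simp add: sum.union_disjoint[OF fin split(2)] sum_negf)
    then show ?thesis
      by (simp add: sum.cartesian_product h_def flip: split(1))
  qed
  then show ?thesis
    using False
    by (simp add: boundary_map_def linear_extension_compose linear_extension_sum chain_smult_sum
        ni power_add linear_extension_def[of "\<lambda>_. 0"] flip: p_def)
qed (simp add: boundary_map_def)


lemma induced_chain_map_closed:
  assumes "c \<in> carrier (chain_space i X)" "continuous_map X Y g"
  shows "induced_chain_map i g c \<in> carrier (chain_space i Y)"
proof -
  have "Poly_Mapping.keys (induced_chain_map i g c)
      \<subseteq> {\<sigma>. 0 \<le> i \<and> singular_simplex (nat i) Y \<sigma>}"
    unfolding induced_chain_map_def
    using assms by (intro keys_linear_extension)
      (auto simp: chain_space_def intro: singular_simplex_simplex_map)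
  then show ?thesis
    by (simp add: chain_space_def)
qed

lemma boundary_map_induced_chain_map:
  fixes c :: "('a, 'k::field) field_chain"
  shows "boundary_map i (induced_chain_map i g c) = induced_chain_map (i - 1) g (boundary_map i c)"
proof (cases "i \<le> 0")
  case False
  then have ni: "nat (i - 1) = nat i - Suc 0" "1 \<le> nat i"
    by auto
  have "singular_face (nat i) k (simplex_map (nat i) g \<sigma>)
      = simplex_map (nat i - Suc 0) g (singular_face (nat i) k \<sigma>)" if "k \<le> nat i" for k and \<sigma> :: "(nat \<Rightarrow> real) \<Rightarrow> 'a"
    using singular_face_simplex_map[of "nat i" k g \<sigma>] that ni
    by (auto simp: simplex_map_def singular_face_def fun_eq_iff)
  then show ?thesis
    using False
    by (simp add: boundary_map_def induced_chain_map_def linear_extension_compose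
        linear_extension_sum ni)
qed (simp add: boundary_map_def induced_chain_map_def)

lemma field_field_ring: "field (field_ring :: 'k::field ring)"
proof -
  have "\<exists>y. x + y = 0" for x :: 'k
    by (rule exI[of _ "- x"]) simp
  moreover have "\<exists>y. x * y = 1" if "x \<noteq> 0" for x :: 'k
    using that by (intro exI[of _ "inverse x"]) simp
  ultimately show ?thesis
    by unfold_locales (auto simp: field_ring_def algebra_simps Units_def)
qed

lemma vectorspace_chain_space:
  fixes X :: "'a topology"
  shows "vectorspace field_ring (chain_space i X :: ('k::field, ('a, 'k) field_chain) module)"
proof -
  let ?S = "{\<sigma>. 0 \<le> i \<and> singular_simplex (nat i) X \<sigma>}"
  have add: "Poly_Mapping.keys (c + d) \<subseteq> ?S" if "Poly_Mapping.keys c \<subseteq> ?S" "Poly_Mapping.keys d \<subseteq> ?S"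
    for c d :: "('a, 'k) field_chain"
    using that keys_add[of c d] by blast
  have smult: "Poly_Mapping.keys (chain_smult a c) \<subseteq> ?S" if "Poly_Mapping.keys c \<subseteq> ?S"
    for a :: 'k and c :: "('a, 'k) field_chain"
    using that keys_chain_smult[of a c] by blast
  have neg: "\<exists>d. Poly_Mapping.keys d \<subseteq> ?S \<and> c + d = 0" if "Poly_Mapping.keys c \<subseteq> ?S"
    for c :: "('a, 'k) field_chain"
    using that by (intro exI[of _ "- c"]) simp
  interpret Ring.field "field_ring :: 'k ring"
    by (rule field_field_ring)
  from is_cring have "Module.module (field_ring :: 'k ring) (chain_space i X :: ('k, ('a, 'k) field_chain) module)"
    by (rule module_criteria)
      (insert add smult neg, auto simp: chain_space_def field_ring_def chain_smult_add algebra_simps)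
  then show ?thesis
    by (simp add: vectorspace_def field_field_ring)
qed

lemma chain_space_simps [simp]:
  "add (chain_space i X) = (+)" "ring.zero (chain_space i X) = 0" "smult (chain_space i X) = chain_smult"
  "add (cycle_space i X) = (+)" "ring.zero (cycle_space i X) = 0" "smult (cycle_space i X) = chain_smult"
  "carrier field_ring = UNIV"
  by (simp_all add: cycle_space_def chain_space_def field_ring_def)

lemma chain_space_closed:
  fixes X :: "'a topology" and c d :: "('a, 'k::field) field_chain"
  shows "0 \<in> carrier (chain_space i X :: ('k, ('a, 'k) field_chain) module)"
    and "c \<in> carrier (chain_space i X) \<Longrightarrow> d \<in> carrier (chain_space i X) \<Longrightarrow>
      c + d \<in> carrier (chain_space i X)"
    and "c \<in> carrier (chain_space i X) \<Longrightarrow> chain_smult a c \<in> carrier (chain_space i X)"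
proof -
  interpret vectorspace field_ring "chain_space i X :: ('k, ('a, 'k) field_chain) module"
    by (rule vectorspace_chain_space)
  show "0 \<in> carrier (chain_space i X :: ('k, ('a, 'k) field_chain) module)"
    using M.zero_closed by simp
  show "c \<in> carrier (chain_space i X) \<Longrightarrow> d \<in> carrier (chain_space i X) \<Longrightarrow>
      c + d \<in> carrier (chain_space i X)"
    using M.a_closed by simp
  show "c \<in> carrier (chain_space i X) \<Longrightarrow> chain_smult a c \<in> carrier (chain_space i X)"
    using smult_closed by simp
qed

lemma subspace_cycle_space:
  "VectorSpace.subspace field_ring (carrier (cycle_space i X)) (chain_space i X)"
  using vectorspace_chain_space[of i X]
  unfolding VectorSpace.subspace_def LinearCombinations.submodule_def vectorspace_def
  by (auto simp: cycle_space_def boundary_map_linear chain_space_closed)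

lemma vectorspace_cycle_space: "vectorspace field_ring (cycle_space i X)"
  using vectorspace.subspace_is_vs[OF vectorspace_chain_space subspace_cycle_space, of i X]
  by (simp add: cycle_space_def)

lemma subspace_boundaries:
  fixes X :: "'a topology"
  shows "VectorSpace.subspace field_ring (boundaries i X)
    (cycle_space i X :: ('k::field, ('a, 'k) field_chain) module)"
proof -
  let ?B = "boundaries i X :: ('a, 'k) field_chain set"
  have "?B \<subseteq> carrier (cycle_space i X)"
    using boundary_map_closed[of _ "i + 1" X]
    by (auto simp: boundaries_def cycle_space_def boundary_map_boundary_map)
  moreover have "0 \<in> ?B"
    unfolding boundaries_def by (rule image_eqI[of _ _ 0]) (auto simp: boundary_map_linear chain_space_closed)
  moreover have "c + d \<in> ?B" if "c \<in> ?B" "d \<in> ?B" for c d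
    using that unfolding boundaries_def by (auto simp flip: boundary_map_linear intro!: imageI chain_space_closed)
  moreover have "chain_smult a c \<in> ?B" if "c \<in> ?B" for a c
    using that unfolding boundaries_def by (auto simp flip: boundary_map_linear intro!: imageI chain_space_closed)
  ultimately show ?thesis
    using vectorspace_cycle_space[of i X]
    unfolding VectorSpace.subspace_def LinearCombinations.submodule_def vectorspace_def by auto
qed

context
  fixes R :: "('r, 'q) ring_scheme" and M :: "('r, 'm) module" and N :: "'m set"
  assumes vs: "vectorspace R M" and sub: "VectorSpace.subspace R N M"
begin

interpretation vectorspace R M
  by (rule vs)

lemma abelian_subgroup_subspace: "abelian_subgroup N M"
proof (rule abelian_subgroupI3)
  show "abelian_group M" ..
  have N: "LinearCombinations.submodule R N M"
    using sub by (simp add: VectorSpace.subspace_def)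
  have minus: "\<ominus>\<^bsub>M\<^esub> x \<in> N" if "x \<in> N" for x
  proof -
    have "x \<in> carrier M"
      using N that by (auto simp: LinearCombinations.submodule_def)
    then have "\<ominus>\<^bsub>M\<^esub> x = (\<ominus>\<^bsub>R\<^esub> \<one>\<^bsub>R\<^esub>) \<odot>\<^bsub>M\<^esub> x"
      by (rule smult_minus_1[symmetric])
    then show ?thesis
      using N that by (simp add: LinearCombinations.submodule_def)
  qed
  show "additive_subgroup N M"
  proof (intro additive_subgroup.intro M.add.subgroupI)
    show "N \<subseteq> carrier M" "N \<noteq> {}"
      using N by (auto simp: LinearCombinations.submodule_def)
  qed (use N minus in \<open>auto simp: LinearCombinations.submodule_def\<close>)
qed

interpretation abelian_subgroup N M
  by (rule abelian_subgroup_subspace)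

lemma quotient_carrier: "carrier (quotient_module M N) = (\<lambda>x. N +>\<^bsub>M\<^esub> x) ` carrier M"
  by (auto simp: quotient_module_def A_RCOSETS_def' )

lemma quotient_smult:
  assumes "a \<in> carrier R" "x \<in> carrier M"
  shows "a \<odot>\<^bsub>quotient_module M N\<^esub> (N +>\<^bsub>M\<^esub> x) = N +>\<^bsub>M\<^esub> (a \<odot>\<^bsub>M\<^esub> x)"
proof -
  have N: "LinearCombinations.submodule R N M"
    using sub by (simp add: VectorSpace.subspace_def)
  have "N +>\<^bsub>M\<^esub> (a \<odot>\<^bsub>M\<^esub> y) = N +>\<^bsub>M\<^esub> (a \<odot>\<^bsub>M\<^esub> x)" if "y \<in> N +>\<^bsub>M\<^esub> x" for y
  proof -
    obtain n where n: "n \<in> N" "y = n \<oplus>\<^bsub>M\<^esub> x"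
      using \<open>y \<in> N +>\<^bsub>M\<^esub> x\<close> by (auto simp: a_r_coset_def')
    then have "n \<in> carrier M"
      using a_subset by blast
    then have "a \<odot>\<^bsub>M\<^esub> y = (a \<odot>\<^bsub>M\<^esub> n) \<oplus>\<^bsub>M\<^esub> (a \<odot>\<^bsub>M\<^esub> x)"
      using n assms by (simp add: smult_r_distr)
    moreover have "a \<odot>\<^bsub>M\<^esub> n \<in> N"
      using N n assms by (simp add: LinearCombinations.submodule_def)
    ultimately have "a \<odot>\<^bsub>M\<^esub> y \<in> N +>\<^bsub>M\<^esub> (a \<odot>\<^bsub>M\<^esub> x)"
      by (auto simp: a_r_coset_def')
    then show ?thesis
      using a_repr_independence[OF _ _ a_subgroup] assms by simp
  qed
  moreover have "x \<in> N +>\<^bsub>M\<^esub> x"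
    using assms by (rule_tac a_rcos_self)
  ultimately have "(\<Union>y\<in>N +>\<^bsub>M\<^esub> x. N +>\<^bsub>M\<^esub> (a \<odot>\<^bsub>M\<^esub> y)) = N +>\<^bsub>M\<^esub> (a \<odot>\<^bsub>M\<^esub> x)"
    by blast
  then show ?thesis
    by (simp add: quotient_module_def)
qed

lemma quotient_add:
  assumes "x \<in> carrier M" "y \<in> carrier M"
  shows "(N +>\<^bsub>M\<^esub> x) \<oplus>\<^bsub>quotient_module M N\<^esub> (N +>\<^bsub>M\<^esub> y) = N +>\<^bsub>M\<^esub> (x \<oplus>\<^bsub>M\<^esub> y)"
  using a_rcos_sum[OF assms] by (simp add: quotient_module_def)

lemma vectorspace_quotient_module: "vectorspace R (quotient_module M N)"
proof -
  have zero: "\<zero>\<^bsub>quotient_module M N\<^esub> = N +>\<^bsub>M\<^esub> \<zero>\<^bsub>M\<^esub>"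
    using a_subset by (simp add: quotient_module_def a_coset_add_zero)
  have "abelian_group (quotient_module M N)"
  proof (rule abelian_groupI)
    fix A B assume "A \<in> carrier (quotient_module M N)" "B \<in> carrier (quotient_module M N)"
    then show "A \<oplus>\<^bsub>quotient_module M N\<^esub> B = B \<oplus>\<^bsub>quotient_module M N\<^esub> A"
      unfolding quotient_carrier using M.a_comm by (auto simp: quotient_add)
  next
    fix A assume "A \<in> carrier (quotient_module M N)"
    then obtain x where x: "x \<in> carrier M" "A = N +>\<^bsub>M\<^esub> x"
      by (auto simp: quotient_carrier)
    then have "(N +>\<^bsub>M\<^esub> \<ominus>\<^bsub>M\<^esub> x) \<oplus>\<^bsub>quotient_module M N\<^esub> A = \<zero>\<^bsub>quotient_module M N\<^esub>"
      by (simp only: quotient_add M.a_inv_closed M.l_neg zero)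
    then show "\<exists>B\<in>carrier (quotient_module M N).
        B \<oplus>\<^bsub>quotient_module M N\<^esub> A = \<zero>\<^bsub>quotient_module M N\<^esub>"
      using x by (auto simp: quotient_carrier)
  qed (auto simp: quotient_carrier quotient_add zero M.a_assoc simp del: a_coset_add_zero)
  moreover have "module_axioms R (quotient_module M N)"
    unfolding module_axioms_def
    by (auto simp: quotient_carrier quotient_smult quotient_add smult_l_distr smult_r_distr smult_assoc1)
  ultimately have "Module.module R (quotient_module M N)"
    using R.is_cring by (simp add: Module.module_def)
  then show ?thesis
    using field_axioms by (simp add: vectorspace_def)
qed

end

lemma vectorspace_homology_module: "vectorspace field_ring (homology_module i X)"
  unfolding homology_module_def
  by (rule vectorspace_quotient_module[OF vectorspace_cycle_space subspace_boundaries])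

lemma induced_chain_map_cycle:
  assumes "c \<in> carrier (cycle_space i X)" "continuous_map X Y g"
  shows "induced_chain_map i g c \<in> carrier (cycle_space i Y)"
proof -
  have "c \<in> carrier (chain_space i X)" "boundary_map i c = 0"
    using assms by (simp_all add: cycle_space_def)
  then show ?thesis
    using induced_chain_map_closed[OF _ assms(2)]
    by (simp add: cycle_space_def boundary_map_induced_chain_map induced_chain_map_linear)
qed

lemma induced_chain_map_boundaries:
  assumes "c \<in> boundaries i X" "continuous_map X Y g"
  shows "induced_chain_map i g c \<in> boundaries i Y"
proof -
  obtain d where d: "d \<in> carrier (chain_space (i + 1) X)" "c = boundary_map (i + 1) d"
    using assms(1) by (auto simp: boundaries_def)
  then have "induced_chain_map i g c = boundary_map (i + 1) (induced_chain_map (i + 1) g d)"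
    by (simp add: boundary_map_induced_chain_map)
  then show ?thesis
    unfolding boundaries_def using induced_chain_map_closed[OF d(1) assms(2)] by (rule image_eqI)
qed

lemma induced_homology_map_coset:
  fixes c :: "('a, 'k::field) field_chain"
  assumes c: "c \<in> carrier (cycle_space i X)" and g: "continuous_map X Y g"
  shows "induced_homology_map i Y g (boundaries i X +>\<^bsub>cycle_space i X\<^esub> c)
    = boundaries i Y +>\<^bsub>cycle_space i Y\<^esub> induced_chain_map i g c"
proof -
  interpret X: abelian_subgroup "boundaries i X" "cycle_space i X :: ('k, ('a, 'k) field_chain) module"
    by (rule abelian_subgroup_subspace[OF vectorspace_cycle_space subspace_boundaries])
  interpret Y: abelian_subgroup "boundaries i Y" "cycle_space i Y :: ('k, ('b, 'k) field_chain) module"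
    by (rule abelian_subgroup_subspace[OF vectorspace_cycle_space subspace_boundaries])
  have "boundaries i Y +>\<^bsub>cycle_space i Y\<^esub> induced_chain_map i g d
      = boundaries i Y +>\<^bsub>cycle_space i Y\<^esub> induced_chain_map i g c"
    if "d \<in> boundaries i X +>\<^bsub>cycle_space i X\<^esub> c" for d
  proof -
    obtain b where "b \<in> boundaries i X" "d = b + c"
      using \<open>d \<in> boundaries i X +>\<^bsub>cycle_space i X\<^esub> c\<close> by (auto simp: a_r_coset_def')
    then have "induced_chain_map i g d \<in> boundaries i Y +>\<^bsub>cycle_space i Y\<^esub> induced_chain_map i g c"
      using induced_chain_map_boundaries[OF _ g]
      by (auto simp: a_r_coset_def' induced_chain_map_linear)
    then show ?thesis
      using Y.a_repr_independence[OF _ _ Y.a_subgroup] induced_chain_map_cycle[OF c g] by simp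
  qed
  moreover have "c \<in> boundaries i X +>\<^bsub>cycle_space i X\<^esub> c"
    using c by (rule X.a_rcos_self)
  ultimately show ?thesis
    unfolding induced_homology_map_def by blast
qed

lemma linear_induced_homology_map:
  fixes X :: "'a topology" and Y :: "'b topology"
  assumes g: "continuous_map X Y g"
  shows "linear_map field_ring (homology_module i X :: ('k::field, ('a, 'k) field_chain set) module)
    (homology_module i Y) (induced_homology_map i Y g)"
proof -
  note sX = vectorspace_cycle_space subspace_boundaries[of i X]
  note sY = vectorspace_cycle_space subspace_boundaries[of i Y]
  interpret X: vectorspace field_ring "cycle_space i X :: ('k, ('a, 'k) field_chain) module"
    by (rule vectorspace_cycle_space)
  note closed = X.M.a_closed[simplified] X.smult_closed[simplified] induced_chain_map_cycle[OF _ g]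
  note [simp] = quotient_add[OF sX, simplified] quotient_add[OF sY, simplified]
    quotient_smult[OF sX, simplified] quotient_smult[OF sY, simplified]
    induced_homology_map_coset[OF _ g] induced_chain_map_linear closed
  have "induced_homology_map i Y g \<in> module_hom field_ring
      (homology_module i X :: ('k, ('a, 'k) field_chain set) module) (homology_module i Y)"
    unfolding module_hom_def homology_module_def quotient_carrier[OF sX] quotient_carrier[OF sY]
  proof (intro CollectI conjI allI impI)
    show "induced_homology_map i Y g \<in>
        (+>\<^bsub>cycle_space i X\<^esub>) (boundaries i X :: ('a, 'k) field_chain set) ` carrier (cycle_space i X) \<rightarrow>
        (+>\<^bsub>cycle_space i Y\<^esub>) (boundaries i Y) ` carrier (cycle_space i Y)"
      by auto
  qed auto
  then show ?thesis
    using vectorspace_homology_module[of i X] vectorspace_homology_module[of i Y]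
    unfolding linear_map_def mod_hom_def mod_hom_axioms_def vectorspace_def by blast
qed

lemma continuous_map_lower_level:
  assumes "u \<le> v"
  shows "continuous_map (lower_level X f u) (lower_level X f v) id"
proof -
  have "f -` {..u} \<subseteq> f -` {..v}"
    using assms by (auto intro: order_trans)
  then show ?thesis
    by (auto simp: lower_level_def continuous_map_in_subtopology intro: continuous_map_from_subtopology)
qed

end

theory Submission
  imports Defs
begin

text \<open>The two persistent modules agree because they are built from the same lower level sets. All
  \<open>l $ j\<close> are positive, so for each point \<open>P\<close> the \<open>n\<close> inequalities \<open>f P $ j \<le> r * l $ j + b $ j\<close>
  can be divided by \<open>l $ j\<close>; together they say that the maximum of the quotients
  \<open>(f P $ j - b $ j) / l $ j\<close> is at most \<open>r\<close>. Hence moving along the line \<open>r *\<^sub>R l + b\<close> filters \<open>X\<close>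
  by \<open>f\<close> exactly as moving \<open>r\<close> along the real axis filters it by \<open>g\<close>. Homology and the maps
  induced by inclusion depend only on these subspaces, and the image modules are therefore
  equal, not merely isomorphic.\<close>

lemma le_line_iff_Max_le:
  fixes x l b :: "real ^ 'n"
  assumes "\<And>j. l $ j > 0"
  shows "x \<le> r *\<^sub>R l + b \<longleftrightarrow> (MAX j. (x $ j - b $ j) / l $ j) \<le> r"
proof -
  have "x \<le> r *\<^sub>R l + b \<longleftrightarrow> (\<forall>j. x $ j - b $ j \<le> r * l $ j)"
    by (simp add: less_eq_vec_def diff_le_eq)
  also have "\<dots> \<longleftrightarrow> (\<forall>j. (x $ j - b $ j) / l $ j \<le> r)"
    using assms by (simp add: pos_divide_le_eq)
  finally show ?thesis
    by simp
qed

text \<open>A point outside \<open>topspace X\<close> may belong to only one of the two preimages in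
  \<^const>\<open>lower_level\<close>, but it contributes nothing to the subspace topology.\<close>

lemma lower_level_cong:
  assumes "\<And>P. P \<in> topspace X \<Longrightarrow> f P \<le> u \<longleftrightarrow> g P \<le> s"
  shows "lower_level X f u = lower_level X g s"
proof -
  have "topspace X \<inter> f -` {..u} = topspace X \<inter> g -` {..s}"
    using assms by auto
  then show ?thesis
    unfolding lower_level_def by (metis subtopology_restrict)
qed

theorem theorem2:
  fixes X :: "'a topology" and f :: "'a \<Rightarrow> real ^ 'n" and g :: "'a \<Rightarrow> real"
    and l b u v :: "real ^ 'n" and s t :: real and i :: int
  assumes "max_tame TYPE('k::field) X f"
    and "admissible l b"
    and "\<And>P. P \<in> topspace X \<Longrightarrow> g P = (MAX j. (f P $ j - b $ j) / l $ j)"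
    and "s < t"
    and "u = s *\<^sub>R l + b" and "v = t *\<^sub>R l + b"
  shows "(persistent_homology_module i X f u v :: ('k, ('a, 'k) field_chain set) module)
    = persistent_homology_module i X g s t"
proof -
  have "l $ j > 0" for j
    using assms(2) by (simp add: admissible_def)
  then have "lower_level X f (r *\<^sub>R l + b) = lower_level X g r" for r
    by (intro lower_level_cong) (simp only: le_line_iff_Max_le assms(3))
  then show ?thesis
    by (simp add: persistent_homology_module_def assms(5,6))
qed

end
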